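(* Let $d$ be a positive integer, let $G=(V,E)$ be a graph on at least $d+2$ vertices, let $u,v\in V$, and put \[U=\{z\in V-\{u,v\}: \{u,v\}\text{ is not } d\text{-linked in } G-z\}.\] If $|U|\le d-1$, then $\{u,v\}$ is $d$-stress-linked in $G$.
   Context: All graphs are finite and simple. A framework in $\mathbb{R}^d$ is a pair $(G,p)$ with $p:V\to\mathbb{R}^d$; it is generic if the coordinates of all $p(v)$ are algebraically independent over $\mathbb{Q}$. The rigidity matrix $R(G,p)$ has a row for each edge $xy$ with $p(x)-p(y)$ in the $d$ columns of $x$, $p(y)-p(x)$ in the $d$ columns of $y$, zeros elsewhere; the generic rigidity matroid $\mathcal{R}_d(G)$ is its row matroid for generic $p$, with rank $r_d(G)$. A pair $\{u,v\}$ is $d$-linked in $G$ if $r_d(G+uv)=r_d(G)$. A stress of a framework $(G,p)$ is a vector $\omega\in\mathbb{R}^E$ with $\sum_{x: xy\in E}\omega(xy)(p(x)-p(y))=0$ for every $y\in V$; $S(G,p)$ denotes the space of stresses. A pair $\{u,v\}$ is $d$-stress-linked in $G$ if it is $d$-linked in $G$ and, for every generic framework $(G,p)$ in $\mathbb{R}^d$ and every framework $(G,q)$ in $\mathbb{R}^d$ with $S(G,p)\subseteq S(G,q)$, we have $S(G+uv,p)\subseteq S(G+uv,q)$ (here $G+uv=G$ if $uv\in E$). *)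

theory Defs
  imports "HOL-Analysis.Analysis" "HOL-Library.Poly_Mapping"
begin

section \<open>Finite simple graphs\<close>

text \<open>
  A graph is a pair of a vertex set and a set of two-element edges. The vertex set is a
  subset of a finite type rather than the whole type, so that vertices can be deleted.
\<close>

type_synonym 'v graph = "'v set \<times> 'v set set"

abbreviation verts :: "'v graph \<Rightarrow> 'v set" where
  "verts \<equiv> fst"

abbreviation edges :: "'v graph \<Rightarrow> 'v set set" where
  "edges \<equiv> snd"

definition simple_graph :: "'v graph \<Rightarrow> bool" where
  "simple_graph G \<longleftrightarrow> finite (verts G) \<and>
     (\<forall>e\<in>edges G. \<exists>x\<in>verts G. \<exists>y\<in>verts G. x \<noteq> y \<and> e = {x, y})"

definition add_edge :: "'v graph \<Rightarrow> 'v \<Rightarrow> 'v \<Rightarrow> 'v graph" where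
  "add_edge G u v = (verts G, insert {u, v} (edges G))"

definition del_vertex :: "'v graph \<Rightarrow> 'v \<Rightarrow> 'v graph" where
  "del_vertex G z = (verts G - {z}, {e \<in> edges G. z \<notin> e})"

section \<open>Generic frameworks\<close>

text \<open>
  A rational polynomial with variables in \<open>'i\<close> is an element of
  \<open>('i \<Rightarrow>\<^sub>0 nat) \<Rightarrow>\<^sub>0 rat\<close>, mapping exponent vectors to coefficients.
\<close>

definition rat_poly_eval :: "('i \<Rightarrow> real) \<Rightarrow> (('i \<Rightarrow>\<^sub>0 nat) \<Rightarrow>\<^sub>0 rat) \<Rightarrow> real" where
  "rat_poly_eval a P =
     (\<Sum>m\<in>Poly_Mapping.keys P. of_rat (Poly_Mapping.lookup P m) *
        (\<Prod>i\<in>Poly_Mapping.keys m. a i ^ Poly_Mapping.lookup m i))"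

definition alg_independent_rat :: "'i set \<Rightarrow> ('i \<Rightarrow> real) \<Rightarrow> bool" where
  "alg_independent_rat I a \<longleftrightarrow>
     (\<forall>P. (\<forall>m\<in>Poly_Mapping.keys P. Poly_Mapping.keys m \<subseteq> I) \<and> rat_poly_eval a P = 0
        \<longrightarrow> P = 0)"

text \<open>
  A framework \<open>(G, p)\<close> is given by a total function \<open>p\<close>, of which only the values on
  \<open>verts G\<close> are ever used.
\<close>

definition generic :: "'v graph \<Rightarrow> ('v \<Rightarrow> real^'d) \<Rightarrow> bool" where
  "generic G p \<longleftrightarrow> alg_independent_rat (verts G \<times> UNIV) (\<lambda>(x, i). p x $ i)"

section \<open>Rigidity matrix and generic rank\<close>

text \<open>
  Rows are indexed by all sets of vertices and columns by pairs of a vertex and a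
  coordinate; rows of non-edges and columns of vertices outside the graph are zero, so they
  do not affect the rank. In the row of an edge \<open>{w, x}\<close> the sum in column \<open>(w, i)\<close>
  has the single term for the other end \<open>x\<close>; for \<open>w\<close> not in \<open>e\<close> it is empty.
\<close>

definition rigidity_matrix ::
    "'v::finite graph \<Rightarrow> ('v \<Rightarrow> real^'d) \<Rightarrow> real^('v \<times> 'd)^('v set)" where
  "rigidity_matrix G p =
     (\<chi> e c. case c of (w, i) \<Rightarrow>
        if e \<in> edges G then \<Sum>x | e = {w, x}. (p w - p x) $ i else 0)"

text \<open>
  The rank \<open>r\<^sub>d(G)\<close> of the generic rigidity matroid is the common rank of the rigidity
  matrices of all generic frameworks of \<open>G\<close>; the dimension is given as
  \<open>d = CARD('d)\<close>.
\<close>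

definition generic_rank :: "'d::finite itself \<Rightarrow> 'v::finite graph \<Rightarrow> nat" where
  "generic_rank _ G =
     (THE r. \<forall>p :: 'v \<Rightarrow> real^'d. generic G p \<longrightarrow> rank (rigidity_matrix G p) = r)"

definition linked :: "'d::finite itself \<Rightarrow> 'v::finite graph \<Rightarrow> 'v \<Rightarrow> 'v \<Rightarrow> bool" where
  "linked d G u v \<longleftrightarrow> generic_rank d (add_edge G u v) = generic_rank d G"

section \<open>Stresses\<close>

text \<open>
  Vectors indexed by the edge set are functions vanishing off the edge set; this identifies
  the stresses of \<open>G\<close> with stresses of \<open>G + uv\<close> that are zero on a new edge \<open>uv\<close>.
\<close>

definition stresses :: "'v graph \<Rightarrow> ('v \<Rightarrow> real^'d) \<Rightarrow> ('v set \<Rightarrow> real) set" where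
  "stresses G p =
     {\<omega>. (\<forall>e. e \<notin> edges G \<longrightarrow> \<omega> e = 0) \<and>
         (\<forall>y\<in>verts G. (\<Sum>x | {x, y} \<in> edges G. \<omega> {x, y} *\<^sub>R (p x - p y)) = 0)}"

definition stress_linked :: "'d::finite itself \<Rightarrow> 'v::finite graph \<Rightarrow> 'v \<Rightarrow> 'v \<Rightarrow> bool" where
  "stress_linked d G u v \<longleftrightarrow> linked d G u v \<and>
     (\<forall>(p :: 'v \<Rightarrow> real^'d) (q :: 'v \<Rightarrow> real^'d). generic G p \<and> stresses G p \<subseteq> stresses G q \<longrightarrow>
        stresses (add_edge G u v) p \<subseteq> stresses (add_edge G u v) q)"

end

theory Submission
  imports Defs
begin

text \<open>
  Let \<open>p\<close> be generic, let \<open>q\<close> satisfy all stresses of \<open>(G, p)\<close>, and let \<open>\<omega>\<close> be a stress of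
  \<open>(G + uv, p)\<close>. For \<open>z \<notin> U \<union> {u, v}\<close> there is a stress of \<open>(G + uv, p)\<close> vanishing at \<open>z\<close> with value
  1 on \<open>uv\<close>; subtracting a multiple of it from \<open>\<omega>\<close> gives a stress of \<open>(G, p)\<close>, hence of
  \<open>(G, q)\<close>, so the net force \<open>F\<close> of \<open>\<omega>\<close> under \<open>q\<close> is zero at \<open>z\<close>. Thus \<open>F\<close> is supported on
  \<open>U \<union> {u, v}\<close>, which has at most \<open>d + 1\<close> elements. As the weighted Laplacian of \<open>\<omega>\<close> is
  symmetric and kills the constants and the coordinates of \<open>p\<close>, each coordinate of \<open>F\<close> is an
  affine dependence of the points \<open>p(w)\<close>, \<open>w \<in> U \<union> {u, v}\<close>. These are affinely independent by
  genericity, so \<open>F = 0\<close>.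
\<close>

section \<open>Rational polynomial functions\<close>

definition monom_eval :: "('i \<Rightarrow> real) \<Rightarrow> ('i \<Rightarrow>\<^sub>0 nat) \<Rightarrow> real" where
  "monom_eval a m = (\<Prod>i\<in>Poly_Mapping.keys m. a i ^ Poly_Mapping.lookup m i)"

lemma monom_eval_superset:
  assumes "finite S" "Poly_Mapping.keys m \<subseteq> S"
  shows "monom_eval a m = (\<Prod>i\<in>S. a i ^ Poly_Mapping.lookup m i)"
  unfolding monom_eval_def using assms
  by (intro prod.mono_neutral_left) (auto simp: in_keys_iff)

lemma monom_eval_add: "monom_eval a (m + n) = monom_eval a m * monom_eval a n"
proof -
  let ?S = "Poly_Mapping.keys m \<union> Poly_Mapping.keys n"
  have "monom_eval a (m + n) = (\<Prod>i\<in>?S. a i ^ Poly_Mapping.lookup (m + n) i)"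
    by (rule monom_eval_superset) (auto simp: keys_add)
  also have "\<dots> = (\<Prod>i\<in>?S. a i ^ Poly_Mapping.lookup m i) * (\<Prod>i\<in>?S. a i ^ Poly_Mapping.lookup n i)"
    by (simp add: lookup_add power_add prod.distrib)
  also have "\<dots> = monom_eval a m * monom_eval a n"
    by (simp add: monom_eval_superset[symmetric])
  finally show ?thesis .
qed

lemma rat_poly_eval_superset:
  assumes "finite S" "Poly_Mapping.keys P \<subseteq> S"
  shows "rat_poly_eval a P = (\<Sum>m\<in>S. of_rat (Poly_Mapping.lookup P m) * monom_eval a m)"
  unfolding rat_poly_eval_def monom_eval_def[symmetric] using assms
  by (intro sum.mono_neutral_left) (auto simp: in_keys_iff)

lemma rat_poly_eval_add: "rat_poly_eval a (P + Q) = rat_poly_eval a P + rat_poly_eval a Q"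
proof -
  let ?S = "Poly_Mapping.keys P \<union> Poly_Mapping.keys Q"
  have "rat_poly_eval a (P + Q) =
      (\<Sum>m\<in>?S. of_rat (Poly_Mapping.lookup (P + Q) m) * monom_eval a m)"
    by (rule rat_poly_eval_superset) (auto simp: keys_add)
  also have "\<dots> = (\<Sum>m\<in>?S. of_rat (Poly_Mapping.lookup P m) * monom_eval a m) +
      (\<Sum>m\<in>?S. of_rat (Poly_Mapping.lookup Q m) * monom_eval a m)"
    by (simp add: lookup_add of_rat_add distrib_right sum.distrib)
  also have "\<dots> = rat_poly_eval a P + rat_poly_eval a Q"
    by (simp add: rat_poly_eval_superset[symmetric])
  finally show ?thesis .
qed

lemma rat_poly_eval_single:
  "rat_poly_eval a (Poly_Mapping.single m c) = of_rat c * monom_eval a m"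
  by (subst rat_poly_eval_superset[of "{m}"]) auto

text \<open>Stating polynomiality for functions gives closure under ring operations, and so under
  determinants, without writing the polynomials down.\<close>

definition rat_poly_fun :: "'i set \<Rightarrow> (('i \<Rightarrow> real) \<Rightarrow> real) \<Rightarrow> bool" where
  "rat_poly_fun I f \<longleftrightarrow>
     (\<exists>P. (\<forall>m\<in>Poly_Mapping.keys P. Poly_Mapping.keys m \<subseteq> I) \<and> f = (\<lambda>a. rat_poly_eval a P))"

lemma rat_poly_fun_monom:
  "Poly_Mapping.keys m \<subseteq> I \<Longrightarrow> rat_poly_fun I (\<lambda>a. of_rat c * monom_eval a m)"
  unfolding rat_poly_fun_def
  by (rule exI[of _ "Poly_Mapping.single m c"]) (auto simp: rat_poly_eval_single)

lemma rat_poly_fun_of_rat: "rat_poly_fun I (\<lambda>a. of_rat c)"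
  using rat_poly_fun_monom[of 0 I c] by (simp add: monom_eval_def)

lemma rat_poly_fun_of_int: "rat_poly_fun I (\<lambda>a. of_int k)"
  using rat_poly_fun_of_rat[of I "of_int k"] by simp

lemma rat_poly_fun_0: "rat_poly_fun I (\<lambda>a. 0)"
  using rat_poly_fun_of_int[of I 0] by simp

lemma rat_poly_fun_1: "rat_poly_fun I (\<lambda>a. 1)"
  using rat_poly_fun_of_int[of I 1] by simp

lemma rat_poly_fun_var: "i \<in> I \<Longrightarrow> rat_poly_fun I (\<lambda>a. a i)"
  using rat_poly_fun_monom[of "Poly_Mapping.single i 1" I 1] by (simp add: monom_eval_def)

lemma rat_poly_fun_add:
  assumes "rat_poly_fun I f" "rat_poly_fun I g"
  shows "rat_poly_fun I (\<lambda>a. f a + g a)"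
proof -
  obtain P Q where "\<forall>m\<in>Poly_Mapping.keys P. Poly_Mapping.keys m \<subseteq> I" "f = (\<lambda>a. rat_poly_eval a P)"
    "\<forall>m\<in>Poly_Mapping.keys Q. Poly_Mapping.keys m \<subseteq> I" "g = (\<lambda>a. rat_poly_eval a Q)"
    using assms unfolding rat_poly_fun_def by blast
  then show ?thesis
    unfolding rat_poly_fun_def using keys_add[of P Q]
    by (intro exI[of _ "P + Q"]) (auto simp: rat_poly_eval_add)
qed

lemma rat_poly_fun_sum:
  "(\<And>x. x \<in> S \<Longrightarrow> rat_poly_fun I (f x)) \<Longrightarrow> rat_poly_fun I (\<lambda>a. \<Sum>x\<in>S. f x a)"
  by (induction S rule: infinite_finite_induct) (simp_all add: rat_poly_fun_0 rat_poly_fun_add)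

text \<open>Expanding the product of two finite sums leaves a finite sum of monomials, and closure
  under sums applies.\<close>

lemma rat_poly_fun_mult:
  assumes "rat_poly_fun I f" "rat_poly_fun I g"
  shows "rat_poly_fun I (\<lambda>a. f a * g a)"
proof -
  obtain P Q where P: "\<forall>m\<in>Poly_Mapping.keys P. Poly_Mapping.keys m \<subseteq> I"
    and f: "f = (\<lambda>a. rat_poly_eval a P)"
    and Q: "\<forall>m\<in>Poly_Mapping.keys Q. Poly_Mapping.keys m \<subseteq> I"
    and g: "g = (\<lambda>a. rat_poly_eval a Q)"
    using assms unfolding rat_poly_fun_def by blast
  have "f a * g a = (\<Sum>m\<in>Poly_Mapping.keys P. \<Sum>n\<in>Poly_Mapping.keys Q.
      of_rat (Poly_Mapping.lookup P m * Poly_Mapping.lookup Q n) * monom_eval a (m + n))" for a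
    unfolding f g rat_poly_eval_def monom_eval_def[symmetric] sum_product
    by (simp add: monom_eval_add of_rat_mult mult_ac)
  moreover have "Poly_Mapping.keys (m + n) \<subseteq> I"
    if "m \<in> Poly_Mapping.keys P" "n \<in> Poly_Mapping.keys Q" for m n
    using that P Q keys_add[of m n] by blast
  ultimately show ?thesis
    by (auto intro!: rat_poly_fun_sum rat_poly_fun_monom)
qed

lemma rat_poly_fun_diff:
  assumes "rat_poly_fun I f" "rat_poly_fun I g"
  shows "rat_poly_fun I (\<lambda>a. f a - g a)"
  using rat_poly_fun_add[OF assms(1) rat_poly_fun_mult[OF rat_poly_fun_of_int[of I "-1"] assms(2)]]
  by simp

lemma rat_poly_fun_prod:
  "(\<And>x. x \<in> S \<Longrightarrow> rat_poly_fun I (f x)) \<Longrightarrow> rat_poly_fun I (\<lambda>a. \<Prod>x\<in>S. f x a)"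
  by (induction S rule: infinite_finite_induct) (simp_all add: rat_poly_fun_1 rat_poly_fun_mult)

lemma rat_poly_fun_det:
  fixes M :: "('i \<Rightarrow> real) \<Rightarrow> real^'n^'n"
  assumes "\<And>i j. rat_poly_fun I (\<lambda>a. M a $ i $ j)"
  shows "rat_poly_fun I (\<lambda>a. det (M a))"
  unfolding det_def
  by (intro rat_poly_fun_sum rat_poly_fun_mult rat_poly_fun_prod rat_poly_fun_of_int assms)

text \<open>This is how genericity is used throughout: one convenient point \<open>b\<close> shows
  that the polynomial is not zero, so it cannot vanish at \<open>a\<close>.\<close>

lemma alg_independent_rat_nonzero:
  assumes "alg_independent_rat I a" "rat_poly_fun I f" "f b \<noteq> 0"
  shows "f a \<noteq> 0"
proof
  assume "f a = 0"
  moreover obtain P where "\<forall>m\<in>Poly_Mapping.keys P. Poly_Mapping.keys m \<subseteq> I"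
    and f: "f = (\<lambda>a. rat_poly_eval a P)"
    using assms(2) unfolding rat_poly_fun_def by blast
  ultimately have "P = 0"
    using assms(1) unfolding alg_independent_rat_def by blast
  then show False
    using assms(3) by (simp add: f rat_poly_eval_def)
qed

section \<open>Rank at generic points\<close>

lemma independent_rows_if_det_nonzero:
  fixes A :: "real^'n^'n"
  assumes "det A \<noteq> 0"
  shows "independent (rows A)"
  using assms det_dependent_rows[of A] by (auto simp: dependent_vec_eq)

lemma inj_row_if_det_nonzero:
  fixes A :: "real^'n^'n"
  assumes "det A \<noteq> 0"
  shows "inj (\<lambda>i. row i A)"
  using assms det_identical_rows[of _ _ A] by (auto simp: inj_def)

text \<open>A row basis of \<open>M b\<close>, padded to a square matrix, has a determinant that is
  polynomial in the point and nonzero at \<open>b\<close>. It is then nonzero at \<open>a\<close>,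
  so the same rows of \<open>M a\<close> are independent.\<close>

lemma rank_le_at_alg_independent:
  fixes M :: "('i \<Rightarrow> real) \<Rightarrow> real^'n^'m"
  assumes M: "\<And>r c. rat_poly_fun I (\<lambda>a. M a $ r $ c)" and a: "alg_independent_rat I a"
  shows "rank (M b) \<le> rank (M a)"
proof -
  obtain B where B: "B \<subseteq> rows (M b)" "independent B" "card B = rank (M b)"
    using basis_exists[of "rows (M b)"] by (metis row_rank_def)
  \<comment> \<open>The padding vectors are taken from the standard basis, so that their entries 0
    and 1 are rational.\<close>
  obtain C where C: "B \<subseteq> C" "C \<subseteq> B \<union> Basis" "independent C" "B \<union> Basis \<subseteq> span C"
    using maximal_independent_subset_extend[OF _ B(2), of "B \<union> Basis"] by blast
  have "span C = UNIV"
    using C(4) span_mono[of Basis "span C"] by (auto simp: span_span)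
  then have "card C = CARD('n)"
    using dim_eq_card_independent[OF C(3)] by (metis DIM_cart DIM_real dim_UNIV dim_span mult.right_neutral)
  moreover have finC: "finite C"
    using C(3) independent_bound by blast
  ultimately obtain h where h: "bij_betw h (UNIV :: 'n set) C"
    by (metis finite finite_same_card_bij)
  have "\<exists>e. h i = row e (M b)" if "h i \<in> B" for i
    using B(1) that by (auto simp: rows_def)
  then obtain e where e: "\<And>i. h i \<in> B \<Longrightarrow> h i = row (e i) (M b)"
    by metis
  \<comment> \<open>Rows chosen from \<open>M\<close> vary with the point, while padding rows stay
    fixed; at \<open>b\<close> the rows of \<open>N\<close> are exactly \<open>C\<close>.\<close>
  define N where "N a = (\<chi> i. if h i \<in> B then row (e i) (M a) else h i)" for a
  have Nb: "row i (N b) = h i" for i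
    using e[of i] by (auto simp: N_def row_def vec_eq_iff)
  have hC: "h i \<in> C" for i
    using h by (auto simp: bij_betw_def)
  have "rows (N b) = C"
    using h by (auto simp: rows_def Nb bij_betw_def)
  then have "rank (N b) = CARD('n)"
    using dim_eq_card_independent[OF C(3)] \<open>card C = CARD('n)\<close> by (simp add: row_rank_def)
  then have "det (N b) \<noteq> 0"
    by (simp add: det_eq_0_rank)
  moreover have "rat_poly_fun I (\<lambda>a. N a $ i $ j)" for i j
  proof (cases "h i \<in> B")
    case True
    then show ?thesis using M by (simp add: N_def row_def)
  next
    case False
    then have "h i \<in> Basis" using hC[of i] C(2) by blast
    then have "h i $ j = 0 \<or> h i $ j = 1"
      by (auto simp: Basis_vec_def axis_def)
    then show ?thesis using False by (auto simp: N_def rat_poly_fun_0 rat_poly_fun_1)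
  qed
  ultimately have "det (N a) \<noteq> 0"
    using alg_independent_rat_nonzero[OF a rat_poly_fun_det] by blast
  let ?J = "{i. h i \<in> B}"
  have "(\<lambda>i. row i (N a)) ` ?J \<subseteq> rows (M a)"
    by (auto simp: N_def rows_def row_def)
  moreover have "independent ((\<lambda>i. row i (N a)) ` ?J)"
    by (rule independent_mono[OF independent_rows_if_det_nonzero[OF \<open>det (N a) \<noteq> 0\<close>]])
      (auto simp: rows_def)
  ultimately have "card ((\<lambda>i. row i (N a)) ` ?J) \<le> rank (M a)"
    unfolding row_rank_def by (rule independent_card_le_dim)
  moreover have "card ((\<lambda>i. row i (N a)) ` ?J) = card ?J"
    by (rule card_image) (rule inj_on_subset[OF inj_row_if_det_nonzero[OF \<open>det (N a) \<noteq> 0\<close>]], simp)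
  moreover have "card ?J = card B"
  proof -
    have "h ` ?J = B" using h C(1) by (auto simp: bij_betw_def)
    moreover have "inj_on h ?J" using h by (auto simp: bij_betw_def inj_on_def)
    ultimately show ?thesis by (metis card_image)
  qed
  ultimately show ?thesis using B(3) by simp
qed

abbreviation coords :: "('v \<Rightarrow> real^'d) \<Rightarrow> 'v \<times> 'd \<Rightarrow> real" where
  "coords p \<equiv> \<lambda>(x, i). p x $ i"

text \<open>Relative to the base point \<open>p w\<close>, the at most d other points give
  difference vectors. They are rows of a square matrix whose determinant is a polynomial that is not
  identically zero.\<close>

lemma generic_affine_independent:
  fixes p :: "'v::finite \<Rightarrow> real^'d"
  assumes gen: "generic G p" and W: "W \<subseteq> verts G" "card W \<le> CARD('d) + 1"
    and sum0: "(\<Sum>w\<in>W. l w) = 0" and sump: "(\<Sum>w\<in>W. l w *\<^sub>R p w) = 0" and "w \<in> W"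
  shows "l w = 0"
proof -
  define W' where "W' = W - {w}"
  have "finite W'" "card W' \<le> card (UNIV :: 'd set)"
    using W(2) \<open>w \<in> W\<close> by (auto simp: W'_def)
  then obtain g :: "'v \<Rightarrow> 'd" where g: "inj_on g W'"
    by (metis card_le_inj finite)
  \<comment> \<open>The map \<open>g\<close> assigns rows to the points of \<open>W'\<close>; any
    row left over is a unit vector.\<close>
  define N :: "('v \<times> 'd \<Rightarrow> real) \<Rightarrow> real^'d^'d" where
    "N a = (\<chi> i j. if i \<in> g ` W' then a (inv_into W' g i, j) - a (w, j) else if i = j then 1 else 0)"
    for a
  have "rat_poly_fun (verts G \<times> UNIV) (\<lambda>a. N a $ i $ j)" for i j
  proof -
    have "inv_into W' g i \<in> verts G" if "i \<in> g ` W'"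
      using inv_into_into[OF that] W(1) by (auto simp: W'_def)
    then show ?thesis
      using W(1) \<open>w \<in> W\<close>
      by (cases "i \<in> g ` W'"; cases "i = j")
        (auto simp: N_def intro!: rat_poly_fun_diff rat_poly_fun_var rat_poly_fun_0 rat_poly_fun_1)
  qed
  \<comment> \<open>Test point: each \<open>x\<close> in \<open>W'\<close> sits at the unit vector
    of index \<open>g x\<close> and \<open>w\<close> at the origin.\<close>
  moreover have "N (\<lambda>(x, j). if x \<in> W' \<and> g x = j then 1 else 0) = mat 1"
    by (simp add: N_def mat_def vec_eq_iff inv_into_into f_inv_into_f) (simp add: W'_def)
  then have "det (N (\<lambda>(x, j). if x \<in> W' \<and> g x = j then 1 else 0)) \<noteq> 0"
    by simp
  ultimately have "det (N (coords p)) \<noteq> 0"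
    using alg_independent_rat_nonzero[OF gen[unfolded generic_def] rat_poly_fun_det] by blast
  then have indep: "(\<Sum>i\<in>UNIV. c i *s row i (N (coords p))) = 0 \<Longrightarrow> c i = 0" for c i
    using matrix_right_invertible_independent_rows[of "N (coords p)"] invertible_det_nz
      invertible_right_inverse by blast
  have "(\<Sum>x\<in>W'. l x *\<^sub>R (p x - p w)) = (\<Sum>x\<in>W. l x *\<^sub>R (p x - p w))"
    using \<open>w \<in> W\<close> by (intro sum.mono_neutral_left) (auto simp: W'_def)
  also have "\<dots> = 0"
    using sum0 sump by (simp add: scaleR_diff_right sum_subtractf flip: scaleR_left.sum)
  finally have W'0: "(\<Sum>x\<in>W'. l x *\<^sub>R (p x - p w)) = 0" .
  define c where "c i = (if i \<in> g ` W' then l (inv_into W' g i) else 0)" for i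
  have "(\<Sum>i\<in>UNIV. c i *s row i (N (coords p))) = (\<Sum>i\<in>g ` W'. c i *s row i (N (coords p)))"
    by (rule sum.mono_neutral_right) (auto simp: c_def)
  also have "\<dots> = (\<Sum>x\<in>W'. l x *\<^sub>R (p x - p w))"
    by (subst sum.reindex[OF g], rule sum.cong)
      (auto simp: c_def N_def row_def vec_eq_iff inv_into_f_f[OF g])
  finally have c0: "c i = 0" for i
    using indep W'0 by simp
  have "l x = 0" if "x \<in> W'" for x
    using c0[of "g x"] that by (simp add: c_def inv_into_f_f[OF g])
  \<comment> \<open>Only the coefficient of the base point remains, and the coefficients sum to
    zero.\<close>
  then have "(\<Sum>x\<in>W. l x) = l w"
    using \<open>w \<in> W\<close> by (subst sum.remove[of W w]) (auto simp: W'_def)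
  then show ?thesis using sum0 by simp
qed

section \<open>Linked pairs\<close>

lemma rigidity_matrix_rat_poly_fun:
  assumes "simple_graph G"
  shows "rat_poly_fun (verts G \<times> UNIV)
    (\<lambda>a. rigidity_matrix G (\<lambda>x. \<chi> i. a (x, i) :: real^'d) $ e $ c)"
proof (cases c)
  case (Pair w i)
  have "w \<in> verts G \<and> x \<in> verts G" if "e \<in> edges G" "e = {w, x}" for x
    using assms that unfolding simple_graph_def by (metis doubleton_eq_iff)
  then show ?thesis
    by (cases "e \<in> edges G")
      (auto simp: rigidity_matrix_def Pair rat_poly_fun_0
        intro!: rat_poly_fun_sum rat_poly_fun_diff rat_poly_fun_var)
qed

text \<open>Two generic frameworks bound each other's rank, so the description in
  \<open>generic_rank\<close> has a unique solution as soon as a generic \<open>p\<close>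
  exists.\<close>

lemma generic_rank_eq:
  fixes p :: "'v::finite \<Rightarrow> real^'d"
  assumes G: "simple_graph G" and p: "generic G p"
  shows "generic_rank TYPE('d) G = rank (rigidity_matrix G p)"
proof -
  have le: "rank (rigidity_matrix G q) \<le> rank (rigidity_matrix G q')" if "generic G q'"
    for q q' :: "'v \<Rightarrow> real^'d"
    using rank_le_at_alg_independent[of _ "\<lambda>a. rigidity_matrix G (\<lambda>x. \<chi> i. a (x, i))",
        OF rigidity_matrix_rat_poly_fun[OF G] that[unfolded generic_def], of "coords q"]
    by simp
  show ?thesis
    unfolding generic_rank_def
    by (rule the_equality) (use le p in \<open>auto intro: antisym\<close>)
qed

section \<open>Adding an edge, deleting a vertex, and linkedness as membership in a span\<close>

lemma simple_graph_add_edge: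
  "simple_graph G \<Longrightarrow> u \<in> verts G \<Longrightarrow> v \<in> verts G \<Longrightarrow> u \<noteq> v \<Longrightarrow> simple_graph (add_edge G u v)"
  by (auto simp: simple_graph_def add_edge_def)

lemma simple_graph_del_vertex: "simple_graph G \<Longrightarrow> simple_graph (del_vertex G z)"
  by (fastforce simp: simple_graph_def del_vertex_def)

lemma generic_add_edge [simp]: "generic (add_edge G u v) p \<longleftrightarrow> generic G p"
  by (simp add: generic_def add_edge_def)

lemma alg_independent_rat_subset:
  "alg_independent_rat I a \<Longrightarrow> J \<subseteq> I \<Longrightarrow> alg_independent_rat J a"
  unfolding alg_independent_rat_def by (meson subset_trans)

lemma generic_del_vertex: "generic G p \<Longrightarrow> generic (del_vertex G z) p"
  unfolding generic_def by (erule alg_independent_rat_subset) (auto simp: del_vertex_def)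

text \<open>Unlike a row of the rigidity matrix, this does not depend on the graph, so it makes
  sense for \<open>{u, v}\<close> before that edge is added.\<close>

abbreviation edge_row :: "('v::finite \<Rightarrow> real^'d) \<Rightarrow> 'v set \<Rightarrow> real^('v \<times> 'd)" where
  "edge_row p e \<equiv> (\<chi> c. case c of (w, i) \<Rightarrow> \<Sum>x | e = {w, x}. (p w - p x) $ i)"

lemma row_rigidity_matrix:
  "row e (rigidity_matrix G p) = (if e \<in> edges G then edge_row p e else 0)"
  by (auto simp: row_def rigidity_matrix_def vec_eq_iff)

lemma span_rows_rigidity_matrix:
  "span (rows (rigidity_matrix G p)) = span (edge_row p ` edges G)"
proof
  show "span (rows (rigidity_matrix G p)) \<subseteq> span (edge_row p ` edges G)"
    by (rule span_minimal, unfold rows_def row_rigidity_matrix)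
      (auto intro: span_base span_zero)
  show "span (edge_row p ` edges G) \<subseteq> span (rows (rigidity_matrix G p))"
  proof (rule span_mono, rule image_subsetI)
    fix e assume "e \<in> edges G"
    then have "edge_row p e = row e (rigidity_matrix G p)"
      by (simp only: row_rigidity_matrix if_True)
    then show "edge_row p e \<in> rows (rigidity_matrix G p)"
      unfolding rows_def by (intro CollectI exI[of _ e]) (simp only: UNIV_I simp_thms)
  qed
qed

text \<open>The same \<open>p\<close> is generic for both graphs, so both ranks are dimensions of
  spans at \<open>p\<close>; inserting a vector keeps the dimension exactly when it lies in the
  span.\<close>

lemma linked_iff_edge_row_in_span:
  fixes p :: "'v::finite \<Rightarrow> real^'d"
  assumes "simple_graph G" "u \<in> verts G" "v \<in> verts G" "u \<noteq> v" "generic G p"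
  shows "linked TYPE('d) G u v \<longleftrightarrow> edge_row p {u, v} \<in> span (edge_row p ` edges G)"
proof -
  let ?R = "edge_row p ` edges G" and ?r = "edge_row p {u, v}"
  have rank: "generic_rank TYPE('d) H = dim (edge_row p ` edges H)"
    if "simple_graph H" "generic H p" for H
    unfolding generic_rank_eq[OF that] row_rank_def
    using arg_cong[OF span_rows_rigidity_matrix[of H p], of dim] unfolding dim_span .
  have "generic_rank TYPE('d) (add_edge G u v) = dim (insert ?r ?R)"
    unfolding rank[OF simple_graph_add_edge[OF assms(1-4)] generic_add_edge[THEN iffD2, OF assms(5)]]
    unfolding add_edge_def snd_conv image_insert ..
  then have "linked TYPE('d) G u v \<longleftrightarrow> dim (insert ?r ?R) = dim ?R"
    unfolding linked_def rank[OF assms(1,5)] by (rule arg_cong)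
  also have "\<dots> \<longleftrightarrow> ?r \<in> span ?R"
    unfolding dim_insert by (cases "?r \<in> span ?R") (simp_all only: if_True if_False simp_thms Suc_eq_plus1[symmetric] Suc_n_not_n)
  finally show ?thesis .
qed

text \<open>A row spanned by the edges avoiding \<open>z\<close> is spanned by all edges. The cases
  on the existence of a generic framework arise because linkedness itself refers to no particular
  \<open>p\<close>.\<close>

lemma linked_if_linked_del_vertex:
  fixes G :: "'v::finite graph"
  assumes "simple_graph G" "u \<in> verts G" "v \<in> verts G" "u \<noteq> v" "z \<noteq> u" "z \<noteq> v"
    and "linked TYPE('d::finite) (del_vertex G z) u v"
  shows "linked TYPE('d) G u v"
proof (cases "\<exists>p :: 'v \<Rightarrow> real^'d. generic G p")
  case True
  then obtain p :: "'v \<Rightarrow> real^'d" where p: "generic G p" by blast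
  have "edge_row p {u, v} \<in> span (edge_row p ` edges (del_vertex G z))"
    using assms linked_iff_edge_row_in_span[OF simple_graph_del_vertex[OF assms(1)] _ _ _
        generic_del_vertex[OF p], of u z v]
    by (auto simp: del_vertex_def)
  also have "\<dots> \<subseteq> span (edge_row p ` edges G)"
    by (intro span_mono image_mono) (auto simp: del_vertex_def)
  finally show ?thesis
    using linked_iff_edge_row_in_span[OF assms(1-4) p] by blast
next
  case False
  \<comment> \<open>Both generic ranks are then the same description operator applied to a trivial predicate.\<close>
  then show ?thesis by (simp add: linked_def generic_rank_def)
qed

section \<open>Stresses\<close>

text \<open>The equilibrium sum gets a name because it is also evaluated under \<open>q\<close>,
  where its vanishing is the question.\<close>

definition net_force :: "'v::finite graph \<Rightarrow> ('v \<Rightarrow> real^'d) \<Rightarrow> ('v set \<Rightarrow> real) \<Rightarrow> 'v \<Rightarrow> real^'d" where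
  "net_force G p \<omega> y = (\<Sum>x | {x, y} \<in> edges G. \<omega> {x, y} *\<^sub>R (p x - p y))"

lemma stresses_iff:
  "\<omega> \<in> stresses G p \<longleftrightarrow> (\<forall>e. e \<notin> edges G \<longrightarrow> \<omega> e = 0) \<and> (\<forall>y\<in>verts G. net_force G p \<omega> y = 0)"
  by (simp add: stresses_def net_force_def)

text \<open>The right-hand side does not mention \<open>G\<close>, so net forces in different graphs
  become comparable.\<close>

lemma net_force_UNIV:
  assumes "\<And>e. e \<notin> edges G \<Longrightarrow> \<omega> e = 0"
  shows "net_force G p \<omega> y = (\<Sum>x\<in>UNIV. \<omega> {x, y} *\<^sub>R (p x - p y))"
  unfolding net_force_def by (rule sum.mono_neutral_left) (use assms in auto)

text \<open>Stresses are row dependences of the rigidity matrix; the sign comes from the opposite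
  orientation of the differences.\<close>

lemma net_force_edge_row:
  fixes p :: "'v::finite \<Rightarrow> real^'d"
  shows "net_force G p \<omega> y $ i = - (\<Sum>e\<in>edges G. \<omega> e * edge_row p e $ (y, i))"
proof -
  have "(\<Sum>e\<in>edges G. \<omega> e * edge_row p e $ (y, i)) =
      (\<Sum>e\<in>edges G. \<Sum>x | e = {y, x}. \<omega> e * (p y - p x) $ i)"
    by (simp add: sum_distrib_left)
  also have "\<dots> = (\<Sum>e\<in>edges G. \<Sum>x | {y, x} \<in> edges G \<and> {y, x} = e. \<omega> {y, x} * (p y - p x) $ i)"
    by (intro sum.cong) auto
  \<comment> \<open>Grouping the neighbours \<open>x\<close> of \<open>y\<close> by the edge
    \<open>{y, x}\<close> merges the double sum.\<close>
  also have "\<dots> = (\<Sum>x | {y, x} \<in> edges G. \<omega> {y, x} * (p y - p x) $ i)"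
    using sum.group[of "{x. {y, x} \<in> edges G}" "edges G" "\<lambda>x. {y, x}"
        "\<lambda>x. \<omega> {y, x} * (p y - p x) $ i"] by auto
  finally show ?thesis
    by (simp add: net_force_def insert_commute right_diff_distrib flip: sum_negf)
qed

lemma span_image_sum:
  assumes "finite A" "x \<in> span (f ` A)"
  shows "\<exists>c. x = (\<Sum>a\<in>A. c a *\<^sub>R f a)"
  using assms(2)
proof (induction rule: span_induct_alt)
  case base
  show ?case by (rule exI[of _ "\<lambda>_. 0"]) simp
next
  case (step k y z)
  then obtain a c where "a \<in> A" "y = f a" "z = (\<Sum>a\<in>A. c a *\<^sub>R f a)" by blast
  then have "k *\<^sub>R y + z = (\<Sum>b\<in>A. (c b + (if b = a then k else 0)) *\<^sub>R f b)"
    using assms(1) by (simp add: scaleR_add_left sum.distrib if_distrib[of "\<lambda>r. r *\<^sub>R _"] cong: if_cong)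
  then show ?case by (rule exI[where x = "\<lambda>b. c b + (if b = a then k else 0)"])
qed

text \<open>Moving the combination to the other side of the equation gives a row dependence with
  coefficient 1 on \<open>{u, v}\<close>.\<close>

lemma stress_of_edge_row_in_span:
  fixes p :: "'v::finite \<Rightarrow> real^'d"
  assumes "{u, v} \<notin> edges G" "edge_row p {u, v} \<in> span (edge_row p ` edges G)"
  obtains \<omega> where "\<omega> {u, v} = 1" "\<And>e. e \<notin> edges (add_edge G u v) \<Longrightarrow> \<omega> e = 0"
    "\<And>y. net_force (add_edge G u v) p \<omega> y = 0"
proof -
  obtain c where c: "edge_row p {u, v} = (\<Sum>e\<in>edges G. c e *\<^sub>R edge_row p e)"
    using span_image_sum[OF _ assms(2)] by auto
  define \<omega> where "\<omega> e = (if e = {u, v} then 1 else if e \<in> edges G then - c e else 0)" for e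
  have "(\<Sum>e\<in>edges (add_edge G u v). \<omega> e *\<^sub>R edge_row p e) =
      edge_row p {u, v} + (\<Sum>e\<in>edges G. \<omega> e *\<^sub>R edge_row p e)"
    using assms(1) by (simp add: add_edge_def \<omega>_def)
  also have "(\<Sum>e\<in>edges G. \<omega> e *\<^sub>R edge_row p e) = - (\<Sum>e\<in>edges G. c e *\<^sub>R edge_row p e)"
    unfolding sum_negf[symmetric] by (rule sum.cong) (use assms(1) in \<open>auto simp: \<omega>_def\<close>)
  finally have 0: "(\<Sum>e\<in>edges (add_edge G u v). \<omega> e *\<^sub>R edge_row p e) = 0"
    using c by simp
  have "net_force (add_edge G u v) p \<omega> y $ i = 0" for y i
    using arg_cong[OF 0, of "\<lambda>x. x $ (y, i)"] unfolding net_force_edge_row by simp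
  then show thesis
    by (intro that[of \<omega>]) (auto simp: \<omega>_def add_edge_def vec_eq_iff)
qed

text \<open>The weighted Laplacian of \<open>\<omega>\<close> is symmetric, so its image is orthogonal to its kernel.\<close>

lemma net_force_orthogonal:
  fixes q :: "'v::finite \<Rightarrow> real^'d" and h :: "'v \<Rightarrow> real"
  assumes supp: "\<And>e. e \<notin> edges G \<Longrightarrow> \<omega> e = 0"
    and h: "\<And>y. (\<Sum>x\<in>UNIV. \<omega> {x, y} * (h x - h y)) = 0"
  shows "(\<Sum>y\<in>UNIV. h y *\<^sub>R net_force G q \<omega> y) = 0"
proof -
  have "(\<Sum>y\<in>UNIV. h y *\<^sub>R net_force G q \<omega> y) =
      (\<Sum>y\<in>UNIV. \<Sum>x\<in>UNIV. (\<omega> {x, y} * h y) *\<^sub>R q x) -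
      (\<Sum>y\<in>UNIV. \<Sum>x\<in>UNIV. (\<omega> {x, y} * h y) *\<^sub>R q y)"
    using supp
    by (simp add: net_force_UNIV scaleR_sum_right scaleR_diff_right sum_subtractf mult_ac)
  also have "(\<Sum>y\<in>UNIV. \<Sum>x\<in>UNIV. (\<omega> {x, y} * h y) *\<^sub>R q x) =
      (\<Sum>y\<in>UNIV. \<Sum>x\<in>UNIV. (\<omega> {x, y} * h x) *\<^sub>R q y)"
    \<comment> \<open>Exchanging the indices leaves the weight unchanged, as
      \<open>{x, y} = {y, x}\<close>: this is the symmetry of the Laplacian.\<close>
    by (subst sum.swap) (simp add: insert_commute)
  also have "\<dots> - (\<Sum>y\<in>UNIV. \<Sum>x\<in>UNIV. (\<omega> {x, y} * h y) *\<^sub>R q y) =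
      (\<Sum>y\<in>UNIV. (\<Sum>x\<in>UNIV. \<omega> {x, y} * (h x - h y)) *\<^sub>R q y)"
    by (simp add: scaleR_sum_left right_diff_distrib scaleR_diff_left sum_subtractf)
  finally show ?thesis using h by simp
qed

text \<open>Orthogonality to the constants and to the coordinates of \<open>p\<close> makes each
  coordinate of the net force under \<open>q\<close> an affine dependence of the points of
  \<open>W\<close>, which are too few to have a nontrivial one.\<close>

lemma stress_if_net_force_supported:
  fixes p q :: "'v::finite \<Rightarrow> real^'d"
  assumes G: "simple_graph G" and p: "generic G p" and \<omega>: "\<omega> \<in> stresses G p"
    and W: "W \<subseteq> verts G" "card W \<le> CARD('d) + 1"
    and F: "\<And>y. y \<in> verts G - W \<Longrightarrow> net_force G q \<omega> y = 0"
  shows "\<omega> \<in> stresses G q"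
proof -
  have supp: "\<And>e. e \<notin> edges G \<Longrightarrow> \<omega> e = 0" using \<omega> by (simp add: stresses_iff)
  have "{x, y} \<notin> edges G" if "y \<notin> verts G" for x y
    using G that unfolding simple_graph_def by (metis doubleton_eq_iff)
  \<comment> \<open>Vertices outside the graph meet no edge, so sums over the whole type are
    harmless.\<close>
  then have out: "net_force G p' \<omega> y = 0" if "y \<notin> verts G" for y and p' :: "'v \<Rightarrow> real^'d"
    using that by (simp add: net_force_def)
  then have "net_force G p \<omega> y = 0" for y
    using \<omega> by (cases "y \<in> verts G") (auto simp: stresses_iff)
  then have "(\<Sum>x\<in>UNIV. \<omega> {x, y} * (p x $ i - p y $ i)) = 0" for y i
    using net_force_UNIV[of G \<omega> p y, OF supp] by (simp add: vec_eq_iff)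
  then have orth_p: "(\<Sum>y\<in>UNIV. p y $ i *\<^sub>R net_force G q \<omega> y) = 0" for i
    by (intro net_force_orthogonal supp)
  have orth_1: "(\<Sum>y\<in>UNIV. net_force G q \<omega> y) = 0"
    using net_force_orthogonal[of G \<omega> "\<lambda>_. 1" q] supp by simp
  have F': "net_force G q \<omega> y = 0" if "y \<notin> W" for y
    using that F out by blast
  have "net_force G q \<omega> y $ j = 0" if "y \<in> W" for y j
  proof (rule generic_affine_independent[OF p W _ _ that])
    have "(\<Sum>w\<in>W. net_force G q \<omega> w $ j) = (\<Sum>w\<in>UNIV. net_force G q \<omega> w $ j)"
      by (rule sum.mono_neutral_left) (use F' in auto)
    then show "(\<Sum>w\<in>W. net_force G q \<omega> w $ j) = 0"
      using orth_1 by (simp flip: sum_component)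
    have "(\<Sum>w\<in>W. net_force G q \<omega> w $ j *\<^sub>R p w) = (\<Sum>w\<in>UNIV. net_force G q \<omega> w $ j *\<^sub>R p w)"
      by (rule sum.mono_neutral_left) (use F' in auto)
    \<comment> \<open>Component \<open>i\<close> of this sum is component \<open>j\<close> of the
      orthogonality relation for the coordinate \<open>i\<close> of \<open>p\<close>.\<close>
    moreover have "\<dots> $ i = 0" for i
      using arg_cong[OF orth_p[of i], of "\<lambda>x. x $ j"] by (simp add: mult.commute)
    ultimately show "(\<Sum>w\<in>W. net_force G q \<omega> w $ j *\<^sub>R p w) = 0"
      by (simp add: vec_eq_iff)
  qed
  then have "net_force G q \<omega> y = 0" for y
    using F'[of y] by (cases "y \<in> W") (auto simp: vec_eq_iff)
  then show ?thesis using supp by (simp add: stresses_iff)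
qed

section \<open>Comparison of the stresses of \<open>add_edge G u v\<close> and \<open>G\<close>, and
  the conclusion\<close>

lemma add_edge_absorb: "{u, v} \<in> edges G \<Longrightarrow> add_edge G u v = G"
  by (cases G) (auto simp: add_edge_def)

lemma net_force_vanishes_if_linked_del_vertex:
  fixes p q :: "'v::finite \<Rightarrow> real^'d"
  assumes G: "simple_graph G" "u \<in> verts G" "v \<in> verts G" "u \<noteq> v" "{u, v} \<notin> edges G"
    and p: "generic G p" and sub: "stresses G p \<subseteq> stresses G q"
    and \<omega>: "\<omega> \<in> stresses (add_edge G u v) p"
    and z: "z \<in> verts G - {u, v}" "linked TYPE('d) (del_vertex G z) u v"
  shows "net_force (add_edge G u v) q \<omega> z = 0"
proof -
  let ?H = "del_vertex G z"
  have "edge_row p {u, v} \<in> span (edge_row p ` edges ?H)"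
    using G z linked_iff_edge_row_in_span[OF simple_graph_del_vertex[OF G(1)] _ _ _
        generic_del_vertex[OF p], of u z v]
    by (auto simp: del_vertex_def)
  then obtain \<omega>z where one: "\<omega>z {u, v} = 1"
    and supp: "\<And>e. e \<notin> edges (add_edge ?H u v) \<Longrightarrow> \<omega>z e = 0"
    and force: "\<And>y. net_force (add_edge ?H u v) p \<omega>z y = 0"
    using stress_of_edge_row_in_span[of u v ?H p] G(5) by (auto simp: del_vertex_def)
  have suppz: "\<omega>z e = 0" if "e \<notin> edges (add_edge G u v)" for e
    using supp[of e] that by (auto simp: add_edge_def del_vertex_def)
  have supp\<omega>: "\<omega> e = 0" if "e \<notin> edges (add_edge G u v)" for e
    using \<omega> that by (simp add: stresses_iff)
  \<comment> \<open>Since \<open>\<omega>z {u, v} = 1\<close>, the coefficient on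
    \<open>{u, v}\<close> cancels and a stress of \<open>G\<close> results.\<close>
  define \<eta> where "\<eta> e = \<omega> e - \<omega> {u, v} * \<omega>z e" for e
  have supp\<eta>: "\<eta> e = 0" if "e \<notin> edges G" for e
    using that one supp\<omega>[of e] suppz[of e] by (cases "e = {u, v}") (auto simp: \<eta>_def add_edge_def)
  \<comment> \<open>Stated for arbitrary \<open>r\<close>, as it serves for \<open>p\<close> to
    obtain a stress and for \<open>q\<close> to read off the force.\<close>
  have force_\<eta>: "net_force G r \<eta> y =
      net_force (add_edge G u v) r \<omega> y - \<omega> {u, v} *\<^sub>R net_force (add_edge G u v) r \<omega>z y"
    for r :: "'v \<Rightarrow> real^'d" and y
    using net_force_UNIV[of G \<eta> r y, OF supp\<eta>]
      net_force_UNIV[of "add_edge G u v" \<omega> r y, OF supp\<omega>]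
      net_force_UNIV[of "add_edge G u v" \<omega>z r y, OF suppz]
    by (simp add: \<eta>_def scaleR_sum_right scaleR_diff_left sum_subtractf)
  have "net_force (add_edge G u v) p \<omega>z y = 0" for y
    using force[of y] by (simp add: net_force_UNIV supp suppz)
  then have "\<eta> \<in> stresses G p"
    using \<omega> supp\<eta> force_\<eta>[of p] by (simp add: stresses_iff add_edge_def)
  then have "net_force G q \<eta> z = 0"
    using sub z(1) unfolding stresses_iff by (auto simp: subset_iff stresses_iff)
  \<comment> \<open>No edge of the graph carrying \<open>\<omega>z\<close> contains
    \<open>z\<close>, so subtracting its multiple changes nothing there.\<close>
  moreover have "\<omega>z {x, z} = 0" for x
    using z(1) by (intro supp) (auto simp: add_edge_def del_vertex_def doubleton_eq_iff)
  then have "net_force (add_edge G u v) q \<omega>z z = 0"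
    by (simp add: net_force_def)
  ultimately show ?thesis
    using force_\<eta>[of q z] by simp
qed

theorem theorem3p3:
  fixes G :: "'v::finite graph" and u v :: 'v and U :: "'v set"
  assumes "simple_graph G"
    and "card (verts G) \<ge> CARD('d::finite) + 2"
    and "u \<in> verts G" and "v \<in> verts G" and "u \<noteq> v"
    and "U = {z \<in> verts G - {u, v}. \<not> linked TYPE('d) (del_vertex G z) u v}"
    and "card U \<le> CARD('d) - 1"
  shows "stress_linked TYPE('d) G u v"
proof (cases "{u, v} \<in> edges G")
  case True
  then show ?thesis by (simp add: stress_linked_def linked_def add_edge_absorb)
next
  case False
  note uv = assms(3-5)
  \<comment> \<open>At least d vertices differ from \<open>u\<close> and \<open>v\<close>, and at
    most d - 1 lie in \<open>U\<close>; positivity of d makes the truncated subtraction exact. A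
    vertex outside \<open>U\<close> yields linkedness in \<open>G\<close>.\<close>
  have "card U < card (verts G - {u, v})"
    using assms(2,7) uv by (simp add: card_Diff_subset) (use zero_less_card_finite[where 'a = 'd] in linarith)
  then obtain z where z: "z \<in> verts G - {u, v}" "z \<notin> U"
    by (metis card_mono finite linorder_not_le subsetI)
  have "linked TYPE('d) G u v"
    using linked_if_linked_del_vertex[OF assms(1) uv, of z] z assms(6) by auto
  moreover have "\<omega> \<in> stresses (add_edge G u v) q"
    if p: "generic G p" and sub: "stresses G p \<subseteq> stresses G q"
      and \<omega>: "\<omega> \<in> stresses (add_edge G u v) p" for p q :: "'v \<Rightarrow> real^'d" and \<omega>
  proof (rule stress_if_net_force_supported[OF simple_graph_add_edge[OF assms(1) uv] _ \<omega>])
    show "generic (add_edge G u v) p" using p by simp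
    show "U \<union> {u, v} \<subseteq> verts (add_edge G u v)"
      using assms(6) uv by (auto simp: add_edge_def)
    have "card (U \<union> {u, v}) \<le> card U + card {u, v}" by (rule card_Un_le)
    moreover have "card {u, v} = 2" using uv(3) by simp
    \<comment> \<open>Again d > 0 is what turns (d - 1) + 2 into d + 1.\<close>
    ultimately show "card (U \<union> {u, v}) \<le> CARD('d) + 1"
      using assms(7) zero_less_card_finite[where 'a = 'd] by linarith
    show "net_force (add_edge G u v) q \<omega> y = 0" if "y \<in> verts (add_edge G u v) - (U \<union> {u, v})" for y
      using net_force_vanishes_if_linked_del_vertex[OF assms(1) uv False p sub \<omega>, of y]
        that assms(6) by (auto simp: add_edge_def)
  qed
  ultimately show ?thesis unfolding stress_linked_def by blast
qed

end
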